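(* Let $n\ge 1$, let $\Omega\subset\mathbb{R}^n$ be a bounded Lipschitz domain with $\operatorname{meas}(\Omega)=1$, and let $s\in(0,1)$. Let $\mathcal{E}_s(q)$ be the threshold function defined in the context, for $q\in(2,2^*_s]$ (for $q\in(2,\infty)$ in the case $n=1$, $s\ge\frac12$). Then the function $q\mapsto\mathcal{E}_s(q)$ is continuous and strictly decreasing on $(2,2^*_s]$ (on $(2,\infty)$ in the case $n=1$, $s\ge\frac12$).
   Context: All functions are real-valued. A domain is a connected open set. For $n\ge2$, or $n=1$ and $s<\frac12$, put $2^*_s:=2n/(n-2s)$. Let $0=\lambda_0<\lambda_1\le\lambda_2\le\dots$ be the eigenvalues of the Neumann Laplacian in $\Omega$ (repeated according to multiplicity), with eigenfunctions $\phi_0,\phi_1,\phi_2,\dots$ forming an orthonormal basis of $L_2(\Omega)$; $\phi_0$ is constant. The quadratic form of the spectral Neumann fractional Laplacian is $$\langle(-\Delta)^s_{Sp}u,u\rangle:=\sum_{j=1}^\infty \lambda_j^s\,(u,\phi_j)_{L_2(\Omega)}^2 .$$ Its domain, i.e. the set of $u\in L_2(\Omega)$ for which this sum is finite, coincides with the Sobolev--Slobodetskii space $\mathcal{H}^s(\Omega)$, which is equipped with the norm $\|u\|^2_{\mathcal{H}^s(\Omega)}:=\langle(-\Delta)^s_{Sp}u,u\rangle+\|u\|^2_{L_2(\Omega)}$ (equivalent to the standard one). For $q$ in the ranges considered the embedding $\mathcal{H}^s(\Omega)\hookrightarrow L_q(\Omega)$ is continuous, and it is compact for $q<2^*_s$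 (for all $q<\infty$ if $n=1$, $s\ge\frac12$). For $\varepsilon>0$ and $u\in\mathcal{H}^s(\Omega)$, $u\ne0$, $$\mathcal{I}^{\varepsilon}_{s,q}[u]:=\frac{\langle(-\Delta)^s_{Sp}u,u\rangle+\varepsilon^{2s}\|u\|^2_{L_2(\Omega)}}{\|u\|^2_{L_q(\Omega)}} .$$ The function $\mathbf{1}$ is identically equal to one, and $\mathcal{I}^{\varepsilon}_{s,q}[\mathbf{1}]=\varepsilon^{2s}$. A function $v$ is a global minimizer of $\mathcal{I}^{\varepsilon}_{s,q}$ if $\mathcal{I}^{\varepsilon}_{s,q}[v]\le\mathcal{I}^{\varepsilon}_{s,q}[u]$ for all nonzero $u\in\mathcal{H}^s(\Omega)$. Definition of $\mathcal{E}_s(q)$: it is the number in $(0,\infty)$ such that for $0<\varepsilon\le\mathcal{E}_s(q)$ the constant function $\mathbf{1}$ is a global minimizer of $\mathcal{I}^{\varepsilon}_{s,q}$, and for $\varepsilon>\mathcal{E}_s(q)$ the constant function $\mathbf{1}$ is not a global minimizer of $\mathcal{I}^{\varepsilon}_{s,q}$. Equivalently, $\mathcal{E}_s(q)=\sup\{\varepsilon>0:\ \mathbf{1}\text{ is a global minimizer of }\mathcal{I}^{\varepsilon}_{s,q}\}$; this is well defined, positive and finite, with $\mathcal{E}_s(q)\le\left(\lambda_1^s/(q-2)\right)^{1/(2s)}$. *)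

theory Defs
  imports "HOL-Analysis.Analysis"
begin

text \<open>A domain is an open connected set.  It is Lipschitz if near each boundary point \<open>p\<close> it is the
  strict epigraph, in some unit direction \<open>e\<close>, of a Lipschitz function \<open>g\<close> on the hyperplane
  orthogonal to \<open>e\<close>; \<open>x - (x \<bullet> e) *\<^sub>R e\<close> is the projection of \<open>x\<close> to that hyperplane.\<close>

definition lipschitz_domain :: "'a::euclidean_space set \<Rightarrow> bool" where
  "lipschitz_domain \<Omega> \<longleftrightarrow> open \<Omega> \<and> connected \<Omega> \<and>
     (\<forall>p\<in>frontier \<Omega>. \<exists>e r L (g :: 'a \<Rightarrow> real).
        norm e = 1 \<and> 0 < r \<and> L-lipschitz_on {y. y \<bullet> e = 0} g \<and>
        \<Omega> \<inter> ball p r = {x \<in> ball p r. g (x - (x \<bullet> e) *\<^sub>R e) < x \<bullet> e})"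


text \<open>Functions on \<open>\<Omega>\<close> are represented by total functions of which only the values on \<open>\<Omega>\<close>, up to
  null sets, matter.\<close>

definition L2_fun :: "'a::euclidean_space set \<Rightarrow> ('a \<Rightarrow> real) \<Rightarrow> bool" where
  "L2_fun \<Omega> u \<longleftrightarrow> u \<in> borel_measurable (lebesgue_on \<Omega>) \<and> integrable (lebesgue_on \<Omega>) (\<lambda>x. (u x)\<^sup>2)"

definition L2_inner :: "'a::euclidean_space set \<Rightarrow> ('a \<Rightarrow> real) \<Rightarrow> ('a \<Rightarrow> real) \<Rightarrow> real" where
  "L2_inner \<Omega> u v = (LINT x|lebesgue_on \<Omega>. u x * v x)"

definition Lq_norm :: "'a::euclidean_space set \<Rightarrow> real \<Rightarrow> ('a \<Rightarrow> real) \<Rightarrow> real" where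
  "Lq_norm \<Omega> q u = (LINT x|lebesgue_on \<Omega>. \<bar>u x\<bar> powr q) powr (1 / q)"


fun Ck_fun :: "nat \<Rightarrow> ('a::euclidean_space \<Rightarrow> real) \<Rightarrow> bool" where
  "Ck_fun 0 f \<longleftrightarrow> continuous_on UNIV f"
| "Ck_fun (Suc k) f \<longleftrightarrow> (\<forall>x. f differentiable (at x)) \<and>
     (\<forall>i\<in>Basis. Ck_fun k (\<lambda>x. frechet_derivative f (at x) i))"

text \<open>The space of smooth functions with compact support in \<open>\<Omega>\<close>, extended by zero.\<close>

definition test_fun :: "'a::euclidean_space set \<Rightarrow> ('a \<Rightarrow> real) \<Rightarrow> bool" where
  "test_fun \<Omega> \<eta> \<longleftrightarrow> (\<forall>k. Ck_fun k \<eta>) \<and>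
     compact (closure {x. \<eta> x \<noteq> 0}) \<and> closure {x. \<eta> x \<noteq> 0} \<subseteq> \<Omega>"

text \<open>\<open>H1_with_grad \<Omega> u G\<close>: \<open>u\<close> belongs to the Sobolev space of functions in \<open>L\<^sub>2(\<Omega>)\<close> with weak
  gradient in \<open>L\<^sub>2(\<Omega>)\<close>, and \<open>G\<close> is this gradient.\<close>

definition H1_with_grad :: "'a::euclidean_space set \<Rightarrow> ('a \<Rightarrow> real) \<Rightarrow> ('a \<Rightarrow> 'a) \<Rightarrow> bool" where
  "H1_with_grad \<Omega> u G \<longleftrightarrow> L2_fun \<Omega> u \<and>
     G \<in> borel_measurable (lebesgue_on \<Omega>) \<and> integrable (lebesgue_on \<Omega>) (\<lambda>x. (norm (G x))\<^sup>2) \<and>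
     (\<forall>\<eta>. test_fun \<Omega> \<eta> \<longrightarrow> (\<forall>i\<in>Basis.
        (LINT x|lebesgue_on \<Omega>. u x * frechet_derivative \<eta> (at x) i) =
        - (LINT x|lebesgue_on \<Omega>. (G x \<bullet> i) * \<eta> x)))"

text \<open>\<open>-\<Delta>u = \<mu>u\<close> with homogeneous Neumann boundary condition, in the weak (variational) sense that
  defines the Neumann Laplacian on a Lipschitz domain.\<close>

definition neumann_eigen :: "'a::euclidean_space set \<Rightarrow> real \<Rightarrow> ('a \<Rightarrow> real) \<Rightarrow> bool" where
  "neumann_eigen \<Omega> \<mu> u \<longleftrightarrow> (\<exists>G. H1_with_grad \<Omega> u G \<and>
     (\<forall>v H. H1_with_grad \<Omega> v H \<longrightarrow>
        (LINT x|lebesgue_on \<Omega>. G x \<bullet> H x) = \<mu> * L2_inner \<Omega> u v))"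

definition orthonormal_basis_L2 :: "'a::euclidean_space set \<Rightarrow> (nat \<Rightarrow> 'a \<Rightarrow> real) \<Rightarrow> bool" where
  "orthonormal_basis_L2 \<Omega> \<phi> \<longleftrightarrow> (\<forall>j. L2_fun \<Omega> (\<phi> j)) \<and>
     (\<forall>j k. L2_inner \<Omega> (\<phi> j) (\<phi> k) = (if j = k then 1 else 0)) \<and>
     (\<forall>u. L2_fun \<Omega> u \<longrightarrow>
        (\<lambda>N. LINT x|lebesgue_on \<Omega>. (u x - (\<Sum>j<N. L2_inner \<Omega> u (\<phi> j) * \<phi> j x))\<^sup>2)
          \<longlonglongrightarrow> 0)"

text \<open>Since the eigenfunctions form an orthonormal basis, the sequence \<open>lam\<close> automatically runs through all
  eigenvalues, each repeated according to its multiplicity.  That \<open>\<phi> 0\<close> is a.e. constant on \<open>\<Omega>\<close>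
  follows.\<close>

definition neumann_eigensystem ::
    "'a::euclidean_space set \<Rightarrow> (nat \<Rightarrow> real) \<Rightarrow> (nat \<Rightarrow> 'a \<Rightarrow> real) \<Rightarrow> bool" where
  "neumann_eigensystem \<Omega> lam \<phi> \<longleftrightarrow> lam 0 = 0 \<and> 0 < lam 1 \<and> mono lam \<and>
     (\<forall>j. neumann_eigen \<Omega> (lam j) (\<phi> j)) \<and> orthonormal_basis_L2 \<Omega> \<phi>"


text \<open>The arguments \<open>lam\<close>, \<open>\<phi>\<close> below are a Neumann eigensystem of \<open>\<Omega>\<close>; the form does not depend on
  its choice.\<close>

definition spectral_form ::
    "'a::euclidean_space set \<Rightarrow> (nat \<Rightarrow> real) \<Rightarrow> (nat \<Rightarrow> 'a \<Rightarrow> real) \<Rightarrow> real \<Rightarrow> ('a \<Rightarrow> real) \<Rightarrow> real" where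
  "spectral_form \<Omega> lam \<phi> s u = (\<Sum>j. lam (Suc j) powr s * (L2_inner \<Omega> u (\<phi> (Suc j)))\<^sup>2)"

definition Hs ::
    "'a::euclidean_space set \<Rightarrow> (nat \<Rightarrow> real) \<Rightarrow> (nat \<Rightarrow> 'a \<Rightarrow> real) \<Rightarrow> real \<Rightarrow> ('a \<Rightarrow> real) set" where
  "Hs \<Omega> lam \<phi> s = {u. L2_fun \<Omega> u \<and>
     summable (\<lambda>j. lam (Suc j) powr s * (L2_inner \<Omega> u (\<phi> (Suc j)))\<^sup>2)}"

definition Hs_nonzero ::
    "'a::euclidean_space set \<Rightarrow> (nat \<Rightarrow> real) \<Rightarrow> (nat \<Rightarrow> 'a \<Rightarrow> real) \<Rightarrow> real \<Rightarrow> ('a \<Rightarrow> real) set" where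
  "Hs_nonzero \<Omega> lam \<phi> s = {u \<in> Hs \<Omega> lam \<phi> s. \<not> (AE x in lebesgue_on \<Omega>. u x = 0)}"

text \<open>Should \<open>u\<close> fail to lie in \<open>L\<^sub>q\<close> (which the Sobolev embedding excludes for the exponents of
  interest), then \<open>Lq_norm\<close> and hence the quotient are \<open>0\<close>, in accordance with dividing by infinity.\<close>

definition quotient_I ::
    "'a::euclidean_space set \<Rightarrow> (nat \<Rightarrow> real) \<Rightarrow> (nat \<Rightarrow> 'a \<Rightarrow> real) \<Rightarrow> real \<Rightarrow> real \<Rightarrow> real \<Rightarrow>
      ('a \<Rightarrow> real) \<Rightarrow> real" where
  "quotient_I \<Omega> lam \<phi> s q \<epsilon> u =
     (spectral_form \<Omega> lam \<phi> s u + \<epsilon> powr (2 * s) * (Lq_norm \<Omega> 2 u)\<^sup>2) / (Lq_norm \<Omega> q u)\<^sup>2"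

definition global_minimizer ::
    "'a::euclidean_space set \<Rightarrow> (nat \<Rightarrow> real) \<Rightarrow> (nat \<Rightarrow> 'a \<Rightarrow> real) \<Rightarrow> real \<Rightarrow> real \<Rightarrow> real \<Rightarrow>
      ('a \<Rightarrow> real) \<Rightarrow> bool" where
  "global_minimizer \<Omega> lam \<phi> s q \<epsilon> v \<longleftrightarrow> v \<in> Hs_nonzero \<Omega> lam \<phi> s \<and>
     (\<forall>u \<in> Hs_nonzero \<Omega> lam \<phi> s. quotient_I \<Omega> lam \<phi> s q \<epsilon> v \<le> quotient_I \<Omega> lam \<phi> s q \<epsilon> u)"

text \<open>At most one \<open>E\<close> satisfies this.\<close>

definition is_threshold ::
    "'a::euclidean_space set \<Rightarrow> (nat \<Rightarrow> real) \<Rightarrow> (nat \<Rightarrow> 'a \<Rightarrow> real) \<Rightarrow> real \<Rightarrow> real \<Rightarrow> real \<Rightarrow> bool" where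
  "is_threshold \<Omega> lam \<phi> s q E \<longleftrightarrow> 0 < E \<and>
     (\<forall>\<epsilon>. 0 < \<epsilon> \<and> \<epsilon> \<le> E \<longrightarrow> global_minimizer \<Omega> lam \<phi> s q \<epsilon> (\<lambda>x. 1)) \<and>
     (\<forall>\<epsilon>. E < \<epsilon> \<longrightarrow> \<not> global_minimizer \<Omega> lam \<phi> s q \<epsilon> (\<lambda>x. 1))"


definition critical_exponent :: "nat \<Rightarrow> real \<Rightarrow> real" where
  "critical_exponent n s = 2 * real n / (real n - 2 * s)"

definition exponent_range :: "nat \<Rightarrow> real \<Rightarrow> real set" where
  "exponent_range n s =
     (if 2 \<le> n \<or> s < 1 / 2 then {2 <.. critical_exponent n s} else {2 <..})"

end

theory Submission
  imports Defs
begin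

text \<open>The constant function is a minimizer at \<open>\<epsilon>\<close> iff
  \<open>\<epsilon>\<^bsup>2s\<^esup> (\<parallel>u\<parallel>\<^sub>q\<^sup>2 - \<parallel>u\<parallel>\<^sub>2\<^sup>2) \<le> Q(u)\<close> for all \<open>u\<close>, where \<open>Q\<close> is the spectral form.  Interpolation of
  \<open>L\<^sub>q\<close> between \<open>L\<^sub>p\<close> and \<open>L\<^sub>r\<close> makes \<open>\<parallel>u\<parallel>\<^sub>q\<^sup>2\<close>, hence also \<open>E(q)\<^bsup>-2s\<^esup>\<close>, a convex function of
  \<open>1/q\<close>, and the latter vanishes in the limit \<open>q = 2\<close>; this gives strict monotonicity and continuity
  from the right.  Continuity from the left holds because \<open>E\<close> is an infimum of functions that are
  continuous in \<open>q\<close>.  No compactness is needed, and integrability of \<open>\<bar>u\<bar>\<^bsup>q\<^esup>\<close> is a consequence of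
  the minimality of the constant function, because the quotient is \<open>0\<close> outside \<open>L\<^sub>q\<close>.\<close>

section \<open>Hoelder's inequality, interpolation and continuity of the norms in the
  exponent\<close>

text \<open>Integrate Young's inequality for the normalized functions \<open>f / A\<close> and
  \<open>g / B\<close>. \<open>integral_mono'\<close> asks for integrability of the nonnegative
  majorant only, so the product on the left needs no separate treatment.\<close>

lemma Holder_integral_powr:
  fixes f g :: "'b \<Rightarrow> real"
  assumes "integrable M f" and "integrable M g"
    and nn: "\<And>x. 0 \<le> f x" "\<And>x. 0 \<le> g x"
    and A: "0 < (LINT x|M. f x)" and B: "0 < (LINT x|M. g x)"
    and t: "0 \<le> \<alpha>" "0 \<le> \<beta>" "\<alpha> + \<beta> = 1"
  shows "(LINT x|M. f x powr \<alpha> * g x powr \<beta>) \<le> (LINT x|M. f x) powr \<alpha> * (LINT x|M. g x) powr \<beta>"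
proof -
  define A where "A = (LINT x|M. f x)"
  define B where "B = (LINT x|M. g x)"
  define C where "C = A powr \<alpha> * B powr \<beta>"
  have pos: "0 < A" "0 < B" "0 < C" using A B by (auto simp: A_def B_def C_def)
  have "(LINT x|M. f x powr \<alpha> * g x powr \<beta>) \<le> (LINT x|M. C * (\<alpha> / A * f x + \<beta> / B * g x))"
  proof (rule integral_mono')
    show "integrable M (\<lambda>x. C * (\<alpha> / A * f x + \<beta> / B * g x))" using assms by auto
    show "0 \<le> C * (\<alpha> / A * f x + \<beta> / B * g x)" for x using pos t nn by auto
    show "f x powr \<alpha> * g x powr \<beta> \<le> C * (\<alpha> / A * f x + \<beta> / B * g x)" for x
    \<comment> \<open>Young's inequality is applied to positive numbers. If a factor is zero, the
      left side is 0 even for exponent 0, because \<open>0 powr 0 = 0\<close>.\<close>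
    proof (cases "f x = 0 \<or> g x = 0")
      case True
      then show ?thesis using pos t nn by auto
    next
      case False
      then have "0 < f x / A" "0 < g x / B"
        using nn[of x] pos by (auto simp: less_le)
      from Youngs_inequality_0[OF t this]
      have "f x powr \<alpha> * g x powr \<beta> / C \<le> \<alpha> / A * f x + \<beta> / B * g x"
        using nn[of x] pos by (simp add: powr_divide C_def)
      then show ?thesis using pos by (simp add: pos_divide_le_eq mult.commute)
    qed
  qed
  also have "\<dots> = C * (\<alpha> / A * A + \<beta> / B * B)" using assms by (simp add: A_def B_def)
  also have "\<dots> = C" using pos t by simp
  finally show ?thesis by (simp add: A_def B_def C_def)
qed

text \<open>The integral of a non-integrable function is 0 by convention, so a positive
  \<open>Lq_norm\<close> encodes membership in the Lebesgue space as well as being nonzero.\<close>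

lemma Lq_norm_posD:
  assumes "0 < Lq_norm \<Omega> q u"
  shows "0 < (LINT x|lebesgue_on \<Omega>. \<bar>u x\<bar> powr q)"
    and "integrable (lebesgue_on \<Omega>) (\<lambda>x. \<bar>u x\<bar> powr q)"
proof -
  have "(LINT x|lebesgue_on \<Omega>. \<bar>u x\<bar> powr q) \<noteq> 0"
    using assms by (auto simp: Lq_norm_def)
  then show "0 < (LINT x|lebesgue_on \<Omega>. \<bar>u x\<bar> powr q)"
    using Bochner_Integration.integral_nonneg[of "lebesgue_on \<Omega>" "\<lambda>x. \<bar>u x\<bar> powr q"] by (simp add: less_le)
  then show "integrable (lebesgue_on \<Omega>) (\<lambda>x. \<bar>u x\<bar> powr q)"
    using not_integrable_integral_eq by force
qed

text \<open>Hoelder's inequality shows that the norm is log-convex in \<open>1/q\<close>; the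
  weighted arithmetic-geometric mean inequality, applied to the squared norms, turns this into
  convexity.\<close>

lemma Lq_norm_sq_interpolation:
  assumes N: "0 < Lq_norm \<Omega> p u" "0 < Lq_norm \<Omega> r u"
    and pos: "0 < p" "0 < q" "0 < r" and \<theta>: "0 \<le> \<theta>" "\<theta> \<le> 1"
    and q: "1 / q = (1 - \<theta>) / p + \<theta> / r"
  shows "(Lq_norm \<Omega> q u)\<^sup>2 \<le> (1 - \<theta>) * (Lq_norm \<Omega> p u)\<^sup>2 + \<theta> * (Lq_norm \<Omega> r u)\<^sup>2"
proof -
  define A where "A = (LINT x|lebesgue_on \<Omega>. \<bar>u x\<bar> powr p)"
  define B where "B = (LINT x|lebesgue_on \<Omega>. \<bar>u x\<bar> powr r)"
  \<comment> \<open>These are the Hoelder weights: they sum to 1 by the relation for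
    \<open>1 / q\<close>, and they split the power as
    \<open>q = p * \<alpha> + r * \<beta>\<close>.\<close>
  define \<alpha> where "\<alpha> = (1 - \<theta>) * q / p"
  define \<beta> where "\<beta> = \<theta> * q / r"
  have AB: "0 < A" "0 < B" using Lq_norm_posD(1) N by (auto simp: A_def B_def)
  have sum: "\<alpha> + \<beta> = 1"
  proof -
    have "\<alpha> + \<beta> = q * ((1 - \<theta>) / p + \<theta> / r)"
      by (simp add: \<alpha>_def \<beta>_def algebra_simps)
    also have "\<dots> = 1" unfolding q[symmetric] using pos by simp
    finally show ?thesis .
  qed
  have exps: "p * \<alpha> + r * \<beta> = q" using pos by (simp add: \<alpha>_def \<beta>_def field_simps)
  have "(LINT x|lebesgue_on \<Omega>. \<bar>u x\<bar> powr q)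
      = (LINT x|lebesgue_on \<Omega>. (\<bar>u x\<bar> powr p) powr \<alpha> * (\<bar>u x\<bar> powr r) powr \<beta>)"
    by (simp add: powr_powr exps flip: powr_add)
  also have "\<dots> \<le> A powr \<alpha> * B powr \<beta>"
    unfolding A_def B_def
    using Lq_norm_posD[OF N(1)] Lq_norm_posD[OF N(2)] sum \<theta> pos
    by (intro Holder_integral_powr) (auto simp: \<alpha>_def \<beta>_def)
  finally have "Lq_norm \<Omega> q u \<le> (A powr \<alpha> * B powr \<beta>) powr (1 / q)"
    unfolding Lq_norm_def using pos by (intro powr_mono2) auto
  also have "\<dots> = (A powr (1 / p)) powr (1 - \<theta>) * (B powr (1 / r)) powr \<theta>"
    using pos by (simp add: powr_mult powr_powr \<alpha>_def \<beta>_def)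
  finally have "(Lq_norm \<Omega> q u)\<^sup>2 \<le> ((A powr (1 / p)) powr (1 - \<theta>) * (B powr (1 / r)) powr \<theta>)\<^sup>2"
    by (intro power_mono) (auto simp: Lq_norm_def)
  also have "\<dots> = ((A powr (1 / p))\<^sup>2) powr (1 - \<theta>) * ((B powr (1 / r))\<^sup>2) powr \<theta>"
    using AB by (simp add: power2_eq_square powr_mult)
  also have "\<dots> \<le> (1 - \<theta>) * (A powr (1 / p))\<^sup>2 + \<theta> * (B powr (1 / r))\<^sup>2"
    using AB \<theta> by (intro Youngs_inequality_0) auto
  finally show ?thesis by (simp add: Lq_norm_def A_def B_def)
qed

lemma Lq_norm_const_1:
  assumes "measure lebesgue \<Omega> = 1" and "\<Omega> \<in> sets lebesgue"
  shows "Lq_norm \<Omega> q (\<lambda>x. 1) = 1"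
  using assms by (simp add: Lq_norm_def measure_restrict_space)

text \<open>Hoelder's inequality against the constant 1, whose integral is the measure 1.\<close>

lemma Lq_norm_2_le:
  assumes "measure lebesgue \<Omega> = 1" and "\<Omega> \<in> sets lebesgue"
    and "0 < Lq_norm \<Omega> q u" and "2 \<le> q"
  shows "Lq_norm \<Omega> 2 u \<le> Lq_norm \<Omega> q u"
proof -
  \<comment> \<open>Finiteness of the measure is read off from the positive norm of the constant
    with exponent 1.\<close>
  have fin: "integrable (lebesgue_on \<Omega>) (\<lambda>x. 1 :: real)"
    using Lq_norm_posD(2)[of \<Omega> 1 "\<lambda>x. 1"] Lq_norm_const_1[OF assms(1,2), of 1] by simp
  have one: "(LINT x|lebesgue_on \<Omega>. 1 :: real) = 1"
    using assms by (simp add: measure_restrict_space)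
  have "(LINT x|lebesgue_on \<Omega>. \<bar>u x\<bar> powr 2)
      = (LINT x|lebesgue_on \<Omega>. 1 powr (1 - 2 / q) * (\<bar>u x\<bar> powr q) powr (2 / q))"
    using assms by (simp add: powr_powr)
  also have "\<dots> \<le> (LINT x|lebesgue_on \<Omega>. 1) powr (1 - 2 / q)
      * (LINT x|lebesgue_on \<Omega>. \<bar>u x\<bar> powr q) powr (2 / q)"
    using Lq_norm_posD[OF assms(3)] fin one assms(4)
    by (intro Holder_integral_powr) auto
  finally have "(LINT x|lebesgue_on \<Omega>. \<bar>u x\<bar> powr 2) \<le> (LINT x|lebesgue_on \<Omega>. \<bar>u x\<bar> powr q) powr (2 / q)"
    unfolding one by simp
  then have "Lq_norm \<Omega> 2 u \<le> ((LINT x|lebesgue_on \<Omega>. \<bar>u x\<bar> powr q) powr (2 / q)) powr (1 / 2)"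
    unfolding Lq_norm_def by (intro powr_mono2) auto
  then show ?thesis by (simp add: Lq_norm_def powr_powr)
qed

lemma Lq_norm_2_pos:
  assumes "L2_fun \<Omega> u" and "\<not> (AE x in lebesgue_on \<Omega>. u x = 0)"
  shows "0 < Lq_norm \<Omega> 2 u"
proof -
  have int: "integrable (lebesgue_on \<Omega>) (\<lambda>x. (u x)\<^sup>2)" using assms by (simp add: L2_fun_def)
  have "(LINT x|lebesgue_on \<Omega>. (u x)\<^sup>2) \<noteq> 0"
    using integral_nonneg_eq_0_iff_AE[OF int] assms(2) by auto
  then show ?thesis by (simp add: Lq_norm_def)
qed

text \<open>Dominated convergence: for exponents between \<open>p\<close> and \<open>r\<close>, the
  sum of the two extreme powers is an integrable majorant. Larger exponents have no such majorant,
  hence the one-sided limit.\<close>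

lemma tendsto_Lq_norm_left:
  assumes "u \<in> borel_measurable (lebesgue_on \<Omega>)"
    and "0 < Lq_norm \<Omega> p u" and "0 < Lq_norm \<Omega> r u" and "0 < p" and "0 < r"
  shows "((\<lambda>q. Lq_norm \<Omega> q u) \<longlongrightarrow> Lq_norm \<Omega> r u) (at r within {p..r})"
proof -
  have "((\<lambda>q. LINT x|lebesgue_on \<Omega>. \<bar>u x\<bar> powr q) \<longlongrightarrow> (LINT x|lebesgue_on \<Omega>. \<bar>u x\<bar> powr r))
      (at r within {p..r})"
    unfolding tendsto_at_iff_sequentially comp_def
  proof (intro allI impI)
    fix X :: "nat \<Rightarrow> real"
    assume X: "\<forall>i. X i \<in> {p..r} - {r}" and lim: "X \<longlonglongrightarrow> r"
    show "(\<lambda>i. LINT x|lebesgue_on \<Omega>. \<bar>u x\<bar> powr X i)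
        \<longlonglongrightarrow> (LINT x|lebesgue_on \<Omega>. \<bar>u x\<bar> powr r)"
    proof (rule integral_dominated_convergence)
      show "integrable (lebesgue_on \<Omega>) (\<lambda>x. \<bar>u x\<bar> powr p + \<bar>u x\<bar> powr r)"
        using assms by (intro Bochner_Integration.integrable_add Lq_norm_posD(2))
      show "(\<lambda>x. \<bar>u x\<bar> powr r) \<in> borel_measurable (lebesgue_on \<Omega>)"
        "(\<lambda>x. \<bar>u x\<bar> powr X i) \<in> borel_measurable (lebesgue_on \<Omega>)" for i
        using assms(1) by measurable
      have "(\<lambda>i. \<bar>u x\<bar> powr X i) \<longlonglongrightarrow> \<bar>u x\<bar> powr r" for x
        by (cases "u x = 0") (auto intro!: tendsto_powr lim)
      then show "AE x in lebesgue_on \<Omega>. (\<lambda>i. \<bar>u x\<bar> powr X i) \<longlonglongrightarrow> \<bar>u x\<bar> powr r"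
        by simp
      have "\<bar>u x\<bar> powr X i \<le> \<bar>u x\<bar> powr p + \<bar>u x\<bar> powr r" for x i
      proof (cases "\<bar>u x\<bar> \<le> 1")
        case True
        then have "\<bar>u x\<bar> powr X i \<le> \<bar>u x\<bar> powr p" using X by (intro powr_mono') auto
        then show ?thesis by (simp add: add_increasing2)
      next
        case False
        then have "\<bar>u x\<bar> powr X i \<le> \<bar>u x\<bar> powr r" using X by (intro powr_mono) auto
        then show ?thesis by (simp add: add_increasing)
      qed
      then show "AE x in lebesgue_on \<Omega>. norm (\<bar>u x\<bar> powr X i) \<le> \<bar>u x\<bar> powr p + \<bar>u x\<bar> powr r" for i
        by simp
    qed
  qed
  then show ?thesis
    unfolding Lq_norm_def using Lq_norm_posD(1)[OF assms(3)] assms(5)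
    by (intro tendsto_powr tendsto_divide tendsto_const tendsto_ident_at) auto
qed

section \<open>Minimality of the constant function as a family of inequalities\<close>

lemma spectral_form_nonneg:
  assumes "u \<in> Hs \<Omega> lam \<phi> s"
  shows "0 \<le> spectral_form \<Omega> lam \<phi> s u"
  using assms unfolding spectral_form_def Hs_def by (auto intro!: suminf_nonneg)

text \<open>A zero norm would make the quotient of \<open>u\<close> equal to 0, since division by 0
  gives 0, while the constant has quotient at least
  \<open>\<epsilon> powr (2 * s) > 0\<close>.\<close>

lemma minimizer_imp_Lq_norm_pos:
  assumes "measure lebesgue \<Omega> = 1" and "\<Omega> \<in> sets lebesgue"
    and min: "global_minimizer \<Omega> lam \<phi> s q \<epsilon> (\<lambda>x. 1)" and "0 < \<epsilon>"
    and u: "u \<in> Hs_nonzero \<Omega> lam \<phi> s"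
  shows "0 < Lq_norm \<Omega> q u"
proof (rule ccontr)
  assume "\<not> 0 < Lq_norm \<Omega> q u"
  then have "Lq_norm \<Omega> q u = 0" by (simp add: Lq_norm_def)
  then have "quotient_I \<Omega> lam \<phi> s q \<epsilon> (\<lambda>x. 1) \<le> 0"
    using bspec[OF min[unfolded global_minimizer_def, THEN conjunct2] u]
    by (simp add: quotient_I_def[of _ _ _ _ _ _ u])
  moreover have "0 \<le> spectral_form \<Omega> lam \<phi> s (\<lambda>x. 1)"
    using min by (intro spectral_form_nonneg) (simp add: global_minimizer_def Hs_nonzero_def)
  moreover have "0 < \<epsilon> powr (2 * s)" using \<open>0 < \<epsilon>\<close> by simp
  ultimately show False
    using Lq_norm_const_1[OF assms(1,2)] by (simp add: quotient_I_def)
qed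

text \<open>Compares the constant function with \<open>\<phi> 0\<close>, which avoids showing that \<open>\<phi> 0\<close> is constant.\<close>

lemma minimizer_imp_spectral_form_1:
  assumes "measure lebesgue \<Omega> = 1" and "\<Omega> \<in> sets lebesgue"
    and min: "global_minimizer \<Omega> lam \<phi> s q \<epsilon> (\<lambda>x. 1)" and "0 < \<epsilon>" and "2 \<le> q"
    and basis: "orthonormal_basis_L2 \<Omega> \<phi>"
  shows "spectral_form \<Omega> lam \<phi> s (\<lambda>x. 1) = 0"
proof -
  define a where "a = \<epsilon> powr (2 * s)"
  define S where "S = spectral_form \<Omega> lam \<phi> s (\<lambda>x. 1)"
  have a: "0 < a" using \<open>0 < \<epsilon>\<close> by (simp add: a_def)
  have S: "0 \<le> S" unfolding S_def
    using min by (intro spectral_form_nonneg) (simp add: global_minimizer_def Hs_nonzero_def)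
  have inner: "L2_inner \<Omega> (\<phi> 0) (\<phi> j) = (if j = 0 then 1 else 0)" for j
    using basis by (auto simp: orthonormal_basis_L2_def)
  have L2: "L2_fun \<Omega> (\<phi> 0)" using basis by (simp add: orthonormal_basis_L2_def)
  have sq: "(LINT x|lebesgue_on \<Omega>. (\<phi> 0 x)\<^sup>2) = 1"
    using inner[of 0] by (simp add: L2_inner_def power2_eq_square)
  have "\<not> (AE x in lebesgue_on \<Omega>. \<phi> 0 x = 0)"
  proof
    assume "AE x in lebesgue_on \<Omega>. \<phi> 0 x = 0"
    then have "(LINT x|lebesgue_on \<Omega>. (\<phi> 0 x)\<^sup>2) = 0"
      by (intro integral_eq_zero_AE) auto
    then show False using sq by simp
  qed
  then have mem: "\<phi> 0 \<in> Hs_nonzero \<Omega> lam \<phi> s"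
    using L2 by (simp add: Hs_nonzero_def Hs_def inner)
  have N2: "Lq_norm \<Omega> 2 (\<phi> 0) = 1" using sq by (simp add: Lq_norm_def)
  have "0 < Lq_norm \<Omega> q (\<phi> 0)"
    by (rule minimizer_imp_Lq_norm_pos[OF assms(1-4) mem])
  then have "1 \<le> Lq_norm \<Omega> q (\<phi> 0)"
    using Lq_norm_2_le[OF assms(1,2) _ \<open>2 \<le> q\<close>, of "\<phi> 0"] N2 by simp
  then have "a / (Lq_norm \<Omega> q (\<phi> 0))\<^sup>2 \<le> a / 1"
    using a by (intro divide_left_mono) (auto simp: one_le_power)
  moreover have "quotient_I \<Omega> lam \<phi> s q \<epsilon> (\<lambda>x. 1) \<le> quotient_I \<Omega> lam \<phi> s q \<epsilon> (\<phi> 0)"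
    using min mem by (simp add: global_minimizer_def)
  \<comment> \<open>The quotient is \<open>S + a\<close> at the constant. At \<open>\<phi> 0\<close>
    the form vanishes by orthogonality, so the quotient there is at most \<open>a\<close>.\<close>
  ultimately have "S \<le> 0"
    using Lq_norm_const_1[OF assms(1,2)] N2
    by (simp add: quotient_I_def spectral_form_def[of _ _ _ _ "\<phi> 0"] inner S_def flip: a_def)
  with S show ?thesis by (simp add: S_def)
qed

text \<open>The constant has quotient exactly \<open>\<epsilon> powr (2 * s)\<close>; multiplying by
  the positive squared norm of \<open>u\<close> gives the inequality. Vanishing of the form at 1 and
  positivity of the norms do not involve \<epsilon>, so both are obtained from minimality at
  \<open>E\<close> itself.\<close>

lemma minimizer_iff:
  assumes "measure lebesgue \<Omega> = 1" and "\<Omega> \<in> sets lebesgue"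
    and "orthonormal_basis_L2 \<Omega> \<phi>" and "2 \<le> q"
    and E: "is_threshold \<Omega> lam \<phi> s q E" and "0 < \<epsilon>"
  shows "\<epsilon> \<le> E \<longleftrightarrow> (\<forall>u\<in>Hs_nonzero \<Omega> lam \<phi> s.
    \<epsilon> powr (2 * s) * ((Lq_norm \<Omega> q u)\<^sup>2 - (Lq_norm \<Omega> 2 u)\<^sup>2) \<le> spectral_form \<Omega> lam \<phi> s u)"
proof -
  have min: "global_minimizer \<Omega> lam \<phi> s q E (\<lambda>x. 1)" and "0 < E"
    using E by (auto simp: is_threshold_def)
  have one: "(\<lambda>x. 1) \<in> Hs_nonzero \<Omega> lam \<phi> s" using min by (simp add: global_minimizer_def)
  have I1: "quotient_I \<Omega> lam \<phi> s q \<epsilon> (\<lambda>x. 1) = \<epsilon> powr (2 * s)"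
    using minimizer_imp_spectral_form_1[OF assms(1,2) min \<open>0 < E\<close> assms(4,3)]
      Lq_norm_const_1[OF assms(1,2)] by (simp add: quotient_I_def)
  have "\<epsilon> \<le> E \<longleftrightarrow> global_minimizer \<Omega> lam \<phi> s q \<epsilon> (\<lambda>x. 1)"
    using E \<open>0 < \<epsilon>\<close> by (cases "\<epsilon> \<le> E") (auto simp: is_threshold_def)
  also have "\<dots> \<longleftrightarrow> (\<forall>u\<in>Hs_nonzero \<Omega> lam \<phi> s. \<epsilon> powr (2 * s) \<le> quotient_I \<Omega> lam \<phi> s q \<epsilon> u)"
    using one I1 by (simp add: global_minimizer_def)
  also have "\<dots> \<longleftrightarrow> (\<forall>u\<in>Hs_nonzero \<Omega> lam \<phi> s.
    \<epsilon> powr (2 * s) * ((Lq_norm \<Omega> q u)\<^sup>2 - (Lq_norm \<Omega> 2 u)\<^sup>2) \<le> spectral_form \<Omega> lam \<phi> s u)"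
  proof (rule ball_cong[OF refl])
    fix u assume "u \<in> Hs_nonzero \<Omega> lam \<phi> s"
    then have "0 < (Lq_norm \<Omega> q u)\<^sup>2"
      using minimizer_imp_Lq_norm_pos[OF assms(1,2) min \<open>0 < E\<close>]
      by (intro zero_less_power)
    from pos_le_divide_eq[OF this] show "(\<epsilon> powr (2 * s) \<le> quotient_I \<Omega> lam \<phi> s q \<epsilon> u) =
      (\<epsilon> powr (2 * s) * ((Lq_norm \<Omega> q u)\<^sup>2 - (Lq_norm \<Omega> 2 u)\<^sup>2) \<le> spectral_form \<Omega> lam \<phi> s u)"
      by (simp only: quotient_I_def right_diff_distrib diff_le_eq)
  qed
  finally show ?thesis .
qed

section \<open>Strict monotonicity and continuity of the threshold\<close>

lemma exponent_range_downward_closed: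
  assumes "r \<in> exponent_range n s" and "2 < q" and "q \<le> r"
  shows "q \<in> exponent_range n s"
  using assms by (auto simp: exponent_range_def split: if_splits)

theorem theorem3:
  fixes \<Omega> :: "'a::euclidean_space set"
    and lam :: "nat \<Rightarrow> real" and \<phi> :: "nat \<Rightarrow> 'a \<Rightarrow> real"
    and s :: real and E :: "real \<Rightarrow> real"
  assumes "lipschitz_domain \<Omega>" and "bounded \<Omega>" and "measure lebesgue \<Omega> = 1"
    and "0 < s" and "s < 1"
    and "neumann_eigensystem \<Omega> lam \<phi>"
    and "\<And>q. q \<in> exponent_range DIM('a) s \<Longrightarrow> is_threshold \<Omega> lam \<phi> s q (E q)"
  shows "continuous_on (exponent_range DIM('a) s) E \<and>
    strict_antimono_on (exponent_range DIM('a) s) E"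
proof -
  define S where "S = exponent_range DIM('a) s"
  define H where "H = Hs_nonzero \<Omega> lam \<phi> s"
  define Q where "Q = spectral_form \<Omega> lam \<phi> s"
  define N where "N = (\<lambda>q u. (Lq_norm \<Omega> q u)\<^sup>2)"
  have \<Omega>: "\<Omega> \<in> sets lebesgue"
    using assms(1) by (auto simp: lipschitz_domain_def intro: lborelD borel_open)
  have basis: "orthonormal_basis_L2 \<Omega> \<phi>"
    using assms(6) by (simp add: neumann_eigensystem_def)
  have thr: "is_threshold \<Omega> lam \<phi> s q (E q)" if "q \<in> S" for q
    using assms(7) that by (simp add: S_def)
  have S2: "2 < q" if "q \<in> S" for q
    using that by (auto simp: S_def exponent_range_def split: if_splits)
  have Sdown: "q \<in> S" if "r \<in> S" "2 < q" "q \<le> r" for q r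
    using that exponent_range_downward_closed by (auto simp: S_def)
  have Epos: "0 < E q" if "q \<in> S" for q
    using thr[OF that] by (simp add: is_threshold_def)
  have iff: "\<epsilon> \<le> E q \<longleftrightarrow> (\<forall>u\<in>H. \<epsilon> powr (2 * s) * (N q u - N 2 u) \<le> Q u)"
    if "q \<in> S" "0 < \<epsilon>" for q \<epsilon>
    using minimizer_iff[OF assms(3) \<Omega> basis _ thr] that S2[of q]
    by (auto simp: H_def N_def Q_def)
  have Qnn: "0 \<le> Q u" if "u \<in> H" for u
    using that spectral_form_nonneg by (auto simp: H_def Hs_nonzero_def Q_def)
  have L2: "L2_fun \<Omega> u" and N2pos: "0 < Lq_norm \<Omega> 2 u" if "u \<in> H" for u
    using that Lq_norm_2_pos by (auto simp: H_def Hs_nonzero_def Hs_def)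
  have Nqpos: "0 < Lq_norm \<Omega> q u" if "u \<in> H" "q \<in> S" for u q
    using thr[OF that(2)] that(1) minimizer_imp_Lq_norm_pos[OF assms(3) \<Omega>]
    unfolding H_def is_threshold_def by blast
  \<comment> \<open>The barycentric coordinate of \<open>1 / q\<close> between \<open>1 / p\<close>
    and \<open>1 / r\<close>.\<close>
  define \<theta> where "\<theta> = (\<lambda>p r q :: real. (1 / p - 1 / q) / (1 / p - 1 / r))"
  have \<theta>: "0 \<le> \<theta> p r q" "\<theta> p r q \<le> 1" "1 / q = (1 - \<theta> p r q) / p + \<theta> p r q / r"
    if "0 < p" "p < r" "p \<le> q" "q \<le> r" for p q r
  proof -
    have pos: "0 < 1 / p - 1 / r" using that by (simp add: frac_less2)
    have "1 / q \<le> 1 / p" "1 / r \<le> 1 / q" using that by (auto intro!: divide_left_mono)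
    then show "0 \<le> \<theta> p r q" "\<theta> p r q \<le> 1"
      using pos by (auto simp: \<theta>_def intro!: divide_nonneg_pos)
    have "\<theta> p r q * (1 / p - 1 / r) = 1 / p - 1 / q" using that by (simp add: \<theta>_def)
    then show "1 / q = (1 - \<theta> p r q) / p + \<theta> p r q / r" by (simp add: algebra_simps diff_divide_distrib)
  qed
  have strict: "E r < E q" if qr: "q \<in> S" "r \<in> S" "q < r" for q r
  proof -
    define t where "t = \<theta> 2 r q"
    have q2: "2 < q" using S2 qr by auto
    have t: "0 < t" "t < 1"
    proof -
      have "1 / q < 1 / 2" "1 / r < 1 / q" using q2 qr(3) by (auto intro!: divide_strict_left_mono)
      then show "0 < t" "t < 1" by (auto simp: t_def \<theta>_def)
    qed
    define c where "c = E r powr (2 * s)"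
    \<comment> \<open>Interpolation between 2 and \<open>r\<close> bounds
      \<open>N q u - N 2 u\<close> by \<open>t * (N r u - N 2 u)\<close>, so the constant
      \<open>c\<close> valid at \<open>r\<close> improves to \<open>c / t\<close> at
      \<open>q\<close>. As \<open>t < 1\<close>, this \<epsilon> exceeds \<open>E r\<close>.\<close>
    define \<epsilon> where "\<epsilon> = (c / t) powr (1 / (2 * s))"
    have c: "0 < c" using Epos[OF qr(2)] by (simp add: c_def)
    then have \<epsilon>: "0 < \<epsilon>" "\<epsilon> powr (2 * s) = c / t"
      using t \<open>0 < s\<close> by (auto simp: \<epsilon>_def powr_powr)
    have "\<epsilon> \<le> E q"
      unfolding iff[OF qr(1) \<epsilon>(1)]
    proof
      fix u assume u: "u \<in> H"
      have "N q u \<le> (1 - t) * N 2 u + t * N r u"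
        unfolding N_def t_def using \<theta>[of 2 r q] q2 qr
        by (intro Lq_norm_sq_interpolation N2pos Nqpos u) auto
      then have "N q u - N 2 u \<le> t * (N r u - N 2 u)" by (simp add: algebra_simps)
      then have "c / t * (N q u - N 2 u) \<le> c / t * (t * (N r u - N 2 u))"
        using c t by (intro mult_left_mono) auto
      also have "\<dots> = c * (N r u - N 2 u)" using t by simp
      also have "\<dots> \<le> Q u"
        using iff[OF qr(2) Epos[OF qr(2)]] u by (simp add: c_def)
      finally show "\<epsilon> powr (2 * s) * (N q u - N 2 u) \<le> Q u" by (simp add: \<epsilon>)
    qed
    moreover have "E r < \<epsilon>"
    proof -
      have "c < c / t" using c t by (simp add: pos_less_divide_eq)
      then have "c powr (1 / (2 * s)) < \<epsilon>"
        unfolding \<epsilon>_def using c \<open>0 < s\<close> by (intro powr_less_mono2) auto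
      then show ?thesis using \<open>0 < s\<close> Epos[OF qr(2)] by (simp add: c_def powr_powr)
    qed
    ultimately show ?thesis by simp
  qed
  \<comment> \<open>Some \<open>u\<close> violates the inequality for \<open>b\<close> at
    \<open>q0\<close>. The violation is strict and persists for \<open>q\<close> slightly below
    \<open>q0\<close>; above \<open>q0\<close>, monotonicity suffices.\<close>
  have upper: "\<forall>\<^sub>F q in at q0 within S. E q < b" if q0: "q0 \<in> S" and b: "E q0 < b" for q0 b
  proof -
    have b0: "0 < b" using Epos[OF q0] b by simp
    then obtain u where u: "u \<in> H" and less: "Q u < b powr (2 * s) * (N q0 u - N 2 u)"
      using iff[OF q0 b0] b by (auto simp: not_le)
    have "((\<lambda>q. Lq_norm \<Omega> q u) \<longlongrightarrow> Lq_norm \<Omega> q0 u) (at q0 within {2..q0})"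
      using L2[OF u] N2pos[OF u] Nqpos[OF u q0] S2[OF q0]
      by (intro tendsto_Lq_norm_left) (auto simp: L2_fun_def)
    then have "((\<lambda>q. b powr (2 * s) * (N q u - N 2 u)) \<longlongrightarrow> b powr (2 * s) * (N q0 u - N 2 u))
        (at q0 within {2..q0})"
      unfolding N_def by (intro tendsto_intros)
    from order_tendstoD(1)[OF this less]
    have "\<forall>\<^sub>F q in at q0 within S. q \<in> {2..q0} \<longrightarrow> Q u < b powr (2 * s) * (N q u - N 2 u)"
      unfolding eventually_at_filter by (rule eventually_mono) auto
    moreover have "\<forall>\<^sub>F q in at q0 within S. q \<in> S" by (simp add: eventually_at_filter)
    ultimately show ?thesis
    proof eventually_elim
      case (elim q)
      show ?case
      proof (cases "q \<le> q0")
        case True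
        then have "\<not> b \<le> E q"
          using iff[OF \<open>q \<in> S\<close> b0] elim S2[OF \<open>q \<in> S\<close>] u by fastforce
        then show ?thesis by simp
      next
        case False
        then show ?thesis using strict[OF q0 \<open>q \<in> S\<close>] b by simp
      qed
    qed
  qed
  have lower: "\<forall>\<^sub>F q in at q0 within S. b < E q" if q0: "q0 \<in> S" and b: "b < E q0" for q0 b
  proof (cases "\<exists>r\<in>S. q0 < r")
    \<comment> \<open>Here \<open>q0\<close> is the right end of \<open>S\<close>, and all other
      exponents are covered by monotonicity.\<close>
    case False
    then have "b < E q" if "q \<in> S" "q \<noteq> q0" for q
      using strict[OF \<open>q \<in> S\<close> q0] that b by force
    then show ?thesis by (auto simp: eventually_at_filter)
  next
    case True
    then obtain r where r: "r \<in> S" "q0 < r" by blast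
    \<comment> \<open>The number \<open>b\<close> may be negative; a positive \<open>c\<close> above
      it is a legitimate value of \<epsilon> in \<open>iff\<close>.\<close>
    obtain c where c: "max 0 b < c" "c < E q0" using dense[of "max 0 b" "E q0"] b Epos[OF q0] by auto
    \<comment> \<open>The chord, affine in \<open>1 / q\<close>, of
      \<open>1 / E q powr (2 * s)\<close> between \<open>q0\<close> and \<open>r\<close>. By
      convexity it lies above that function for \<open>q\<close> in between, and it is continuous at
      \<open>q0\<close>, where the two agree.\<close>
    define g where "g = (\<lambda>q. (1 - \<theta> q0 r q) / E q0 powr (2 * s) + \<theta> q0 r q / E r powr (2 * s))"
    have pos: "0 < E q0" "0 < E r" "2 < q0" using Epos S2 q0 r by auto
    have "\<theta> q0 r \<midarrow>q0\<rightarrow> \<theta> q0 r q0"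
      unfolding \<theta>_def using pos r by (intro tendsto_intros) auto
    then have "g \<midarrow>q0\<rightarrow> g q0"
      unfolding g_def using pos by (intro tendsto_intros) auto
    moreover have "g q0 = 1 / E q0 powr (2 * s)" by (simp add: g_def \<theta>_def)
    moreover have "1 / E q0 powr (2 * s) < 1 / c powr (2 * s)"
      using c pos \<open>0 < s\<close> by (intro divide_strict_left_mono powr_less_mono2 mult_pos_pos) auto
    ultimately have "\<forall>\<^sub>F q in at q0. g q < 1 / c powr (2 * s)"
      using order_tendstoD(2) by metis
    then have "\<forall>\<^sub>F q in at q0 within S. g q < 1 / c powr (2 * s)"
      using eventually_at_filter by (metis at_within_le_at filter_leD)
    moreover have "\<forall>\<^sub>F q in at q0 within S. q < r"
      using order_tendstoD(2)[OF tendsto_ident_at r(2)] .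
    moreover have "\<forall>\<^sub>F q in at q0 within S. q \<in> S" by (simp add: eventually_at_filter)
    ultimately show ?thesis
    proof eventually_elim
      case (elim q)
      show ?case
      proof (cases "q0 < q")
        case False
        then show ?thesis using strict[OF \<open>q \<in> S\<close> q0] b by (cases "q = q0") auto
      next
        case True
        define t where "t = \<theta> q0 r q"
        have t: "0 \<le> t" "t \<le> 1" "1 / q = (1 - t) / q0 + t / r"
          using \<theta>[of q0 r q] True elim pos by (auto simp: t_def)
        have "c \<le> E q"
        proof (subst iff[OF \<open>q \<in> S\<close>])
          show "0 < c" using c by simp
          show "\<forall>u\<in>H. c powr (2 * s) * (N q u - N 2 u) \<le> Q u"
          proof
            fix u assume u: "u \<in> H"
            \<comment> \<open>The inequality at the threshold itself, to be used at both ends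
              \<open>q0\<close> and \<open>r\<close> of the chord.\<close>
            have le: "N p u - N 2 u \<le> Q u / E p powr (2 * s)" if "p \<in> S" for p
              using iff[OF that Epos[OF that]] Epos[OF that] u
              by (simp add: pos_le_divide_eq mult.commute)
            have "N q u \<le> (1 - t) * N q0 u + t * N r u"
              unfolding N_def using t pos True r
              by (intro Lq_norm_sq_interpolation Nqpos u q0) auto
            then have "N q u - N 2 u \<le> (1 - t) * (N q0 u - N 2 u) + t * (N r u - N 2 u)"
              by (simp add: algebra_simps)
            also have "\<dots> \<le> (1 - t) * (Q u / E q0 powr (2 * s)) + t * (Q u / E r powr (2 * s))"
              using t le q0 r by (intro add_mono mult_left_mono) auto
            also have "\<dots> = g q * Q u" by (simp add: g_def t_def distrib_right)
            also have "\<dots> \<le> 1 / c powr (2 * s) * Q u"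
              using elim Qnn[OF u] by (intro mult_right_mono) auto
            finally show "c powr (2 * s) * (N q u - N 2 u) \<le> Q u"
              using c by (simp add: pos_le_divide_eq mult.commute)
          qed
        qed
        then show ?thesis using c by simp
      qed
    qed
  qed
  have "continuous_on S E"
    unfolding continuous_on_def by (intro ballI order_tendstoI upper lower)
  moreover have "strict_antimono_on S E" by (auto simp: monotone_on_def strict)
  ultimately show ?thesis by (simp add: S_def)
qed

end
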